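(* Let $\mathcal{Z}\subseteq\mathbb{R}^n$ be a closed convex set, let $F:\mathcal{Z}\to\mathbb{R}^n$ be a monotone and $L$-Lipschitz operator, and let $z^*\in\mathcal{Z}$ be a solution of the variational inequality, i.e. $\langle F(z^* ),z^*-z\rangle\le 0$ for all $z\in\mathcal{Z}$. Let $z_0\in\mathcal{Z}$ and let $(z_k)_{k\ge0}$ be produced by the extragradient (EG) algorithm started at $z_0$ with any constant step size $\eta\in(0,\frac1L)$. Then for any $T\ge1$ (and any $D>0$): \begin{itemize} \item $\mathrm{Gap}_{\mathcal{Z},F,D}(z_T)\le \dfrac{1}{\sqrt{T}}\,\dfrac{3D\|z_0-z^*\|}{\eta\sqrt{1-(\eta L)^2}}$; \item $r^{nat}_{(F,\mathcal{Z})}(z_T)\le r^{tan}_{(F,\mathcal{Z})}(z_T)\le \dfrac{1}{\sqrt{T}}\,\dfrac{3\|z_0-z^*\|}{\eta\sqrt{1-(\eta L)^2}}$. \end{itemize}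
   Context: $\|\cdot\|$ is the Euclidean norm and $\langle\cdot,\cdot\rangle$ the Euclidean inner product; $\Pi_C$ denotes Euclidean projection onto a closed convex set $C$. $F$ is monotone if $\langle F(z)-F(z'),z-z'\rangle\ge0$ for all $z,z'\in\mathcal{Z}$, and $L$-Lipschitz if $\|F(z)-F(z')\|\le L\|z-z'\|$ for all $z,z'\in\mathcal{Z}$ ($L>0$). EG algorithm: $z_{k+\frac12}=\Pi_{\mathcal{Z}}[z_k-\eta F(z_k)]$, $z_{k+1}=\Pi_{\mathcal{Z}}[z_k-\eta F(z_{k+\frac12})]$ for $k\ge0$. Gap function: $\mathrm{Gap}_{\mathcal{Z},F,D}(z)=\max_{z'\in\mathcal{Z}\cap\mathcal{B}(z,D)}\langle F(z),z-z'\rangle$, where $D>0$ is a fixed parameter and $\mathcal{B}(z,D)$ is the closed ball of radius $D$ centered at $z$. Natural residual: $r^{nat}_{(F,\mathcal{Z})}(z)=\|z-\Pi_{\mathcal{Z}}(z-F(z))\|$. Tangent residual: let $N_{\mathcal{Z}}(z)=\{v\in\mathbb{R}^n:\langle v,z'-z\rangle\le0\ \forall z'\in\mathcal{Z}\}$ be the normal cone, $T_{\mathcal{Z}}(z)=\{z'\in\mathbb{R}^n:\langle z',a\rangle\le0\ \forall a\in N_{\mathcal{Z}}(z)\}$ the tangent cone, and $J_{\mathcal{Z}}(z)=\{z\}+T_{\mathcal{Z}}(z)$. Then $r^{tan}_{(F,\mathcal{Z})}(z)=\|\Pi_{J_{\mathcal{Z}}(z)}[z-F(z)]-z\|$. 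*)

theory Defs
  imports "HOL-Analysis.Analysis"
begin

text \<open>
  An operator on a set \<open>Z\<close> is a total function of which only the values on \<open>Z\<close> matter.
  The Euclidean projection onto a nonempty closed convex set \<open>C\<close> is \<^const>\<open>closest_point\<close> \<open>C\<close>.
\<close>

definition monotone_operator_on :: "'a::real_inner set \<Rightarrow> ('a \<Rightarrow> 'a) \<Rightarrow> bool" where
  "monotone_operator_on Z F \<longleftrightarrow> (\<forall>z\<in>Z. \<forall>z'\<in>Z. (F z - F z') \<bullet> (z - z') \<ge> 0)"

definition vi_solution :: "'a::real_inner set \<Rightarrow> ('a \<Rightarrow> 'a) \<Rightarrow> 'a \<Rightarrow> bool" where
  "vi_solution Z F zs \<longleftrightarrow> zs \<in> Z \<and> (\<forall>z\<in>Z. F zs \<bullet> (zs - z) \<le> 0)"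

definition eg_half :: "'a::euclidean_space set \<Rightarrow> ('a \<Rightarrow> 'a) \<Rightarrow> real \<Rightarrow> 'a \<Rightarrow> 'a" where
  "eg_half Z F \<eta> z = closest_point Z (z - \<eta> *\<^sub>R F z)"

primrec eg :: "'a::euclidean_space set \<Rightarrow> ('a \<Rightarrow> 'a) \<Rightarrow> real \<Rightarrow> 'a \<Rightarrow> nat \<Rightarrow> 'a" where
  "eg Z F \<eta> z0 0 = z0"
| "eg Z F \<eta> z0 (Suc k) =
     closest_point Z (eg Z F \<eta> z0 k - \<eta> *\<^sub>R F (eg_half Z F \<eta> (eg Z F \<eta> z0 k)))"

definition gap :: "'a::euclidean_space set \<Rightarrow> ('a \<Rightarrow> 'a) \<Rightarrow> real \<Rightarrow> 'a \<Rightarrow> real" where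
  "gap Z F D z = (SUP z'\<in>Z \<inter> cball z D. F z \<bullet> (z - z'))"

text \<open>The supremum above is a maximum.\<close>

lemma gap_attained:
  assumes "closed Z" "z \<in> Z" "0 < D"
  shows "\<exists>w\<in>Z \<inter> cball z D. gap Z F D z = F z \<bullet> (z - w) \<and>
           (\<forall>z'\<in>Z \<inter> cball z D. F z \<bullet> (z - z') \<le> F z \<bullet> (z - w))"
proof -
  have "compact (Z \<inter> cball z D)" "Z \<inter> cball z D \<noteq> {}"
    using assms by (auto simp: closed_Int_compact)
  moreover have "continuous_on (Z \<inter> cball z D) (\<lambda>z'. F z \<bullet> (z - z'))"
    by (intro continuous_intros)
  ultimately obtain w where w: "w \<in> Z \<inter> cball z D"
    and max: "\<forall>z'\<in>Z \<inter> cball z D. F z \<bullet> (z - z') \<le> F z \<bullet> (z - w)"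
    using continuous_attains_sup by blast
  have "gap Z F D z = F z \<bullet> (z - w)"
    unfolding gap_def by (rule cSup_eq_maximum) (use w max in auto)
  then show ?thesis using w max by blast
qed

definition natural_residual :: "'a::euclidean_space set \<Rightarrow> ('a \<Rightarrow> 'a) \<Rightarrow> 'a \<Rightarrow> real" where
  "natural_residual Z F z = norm (z - closest_point Z (z - F z))"

definition normal_cone :: "'a::real_inner set \<Rightarrow> 'a \<Rightarrow> 'a set" where
  "normal_cone Z z = {v. \<forall>z'\<in>Z. v \<bullet> (z' - z) \<le> 0}"

definition tangent_cone :: "'a::real_inner set \<Rightarrow> 'a \<Rightarrow> 'a set" where
  "tangent_cone Z z = {z'. \<forall>a\<in>normal_cone Z z. z' \<bullet> a \<le> 0}"

definition shifted_tangent_cone :: "'a::real_inner set \<Rightarrow> 'a \<Rightarrow> 'a set" where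
  "shifted_tangent_cone Z z = (+) z ` tangent_cone Z z"

text \<open>The projection onto the shifted tangent cone is well defined.\<close>

lemma shifted_tangent_cone_closed_convex:
  shows "closed (shifted_tangent_cone Z z)"
    and "convex (shifted_tangent_cone Z z)"
    and "shifted_tangent_cone Z z \<noteq> {}"
proof -
  have eq: "tangent_cone Z z = (\<Inter>a\<in>normal_cone Z z. {x. a \<bullet> x \<le> 0})"
    by (auto simp: tangent_cone_def inner_commute)
  have "closed (tangent_cone Z z)" "convex (tangent_cone Z z)"
    unfolding eq by (auto intro!: closed_INT convex_INT closed_halfspace_le convex_halfspace_le)
  then show "closed (shifted_tangent_cone Z z)" "convex (shifted_tangent_cone Z z)"
    by (auto simp: shifted_tangent_cone_def intro: closed_translation convex_translation)
  have "0 \<in> tangent_cone Z z" by (simp add: tangent_cone_def)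
  then show "shifted_tangent_cone Z z \<noteq> {}" by (auto simp: shifted_tangent_cone_def)
qed

definition tangent_residual :: "'a::euclidean_space set \<Rightarrow> ('a \<Rightarrow> 'a) \<Rightarrow> 'a \<Rightarrow> real" where
  "tangent_residual Z F z = norm (closest_point (shifted_tangent_cone Z z) (z - F z) - z)"

end

theory Submission
  imports Defs
begin

text \<open>
  Write \<open>z\<close>, \<open>w\<close>, \<open>z\<^sup>+\<close> for an iterate, its half step and the next iterate.  The vector
  \<open>d = z - \<eta> F w - z\<^sup>+\<close> is normal to \<open>Z\<close> at \<open>z\<^sup>+\<close> because \<open>z\<^sup>+\<close> is a projection, so
  \<open>g = \<eta> F z\<^sup>+ + d\<close> belongs to \<open>\<eta> F z\<^sup>+ + N\<^sub>Z(z\<^sup>+)\<close>.  By Moreau's decomposition the tangent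
  residual at a point \<open>x\<close> is the least norm of an element of \<open>F x + N\<^sub>Z(x)\<close>
  (\<open>tangent_residual_le\<close>, \<open>tangent_residual_eq\<close>), and any element of that set bounds the gap
  and the natural residual too.  Since normal cones are invariant under positive scaling,
  \<open>g / \<eta>\<close> is such an element at \<open>x = z\<^sup>+\<close>, and it is enough to bound \<open>\<parallel>g\<parallel>\<close> at the last iterate.

  This bound combines two facts.
  \<^item> The norm of \<open>g\<close> does not increase along the iteration (\<open>eg_residual_decreasing\<close>): in fact
    \<open>\<parallel>g\<parallel> \<le> \<parallel>\<eta> F z + c\<parallel>\<close> for every \<open>c \<in> N\<^sub>Z(z)\<close>.  The difference of the squares is, by the identity
    \<open>eg_square_identity\<close>, a sum of terms that are nonnegative by monotonicity of \<open>F\<close>, by its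
    Lipschitz continuity with \<open>\<eta> L \<le> 1\<close>, by the definition of the normal cones at \<open>z\<close>, \<open>w\<close>, \<open>z\<^sup>+\<close>,
    and because one of them is a square.
  \<^item> The squares \<open>\<parallel>z - w\<parallel>\<^sup>2\<close> have sum at most \<open>\<parallel>z\<^sub>0 - z\<^sup>*\<parallel>\<^sup>2 / (1 - (\<eta> L)\<^sup>2)\<close>
    (\<open>eg_step_fejer\<close>), and \<open>\<parallel>g\<parallel> \<le> 3 \<parallel>z - w\<parallel>\<close> (\<open>eg_residual_le_half_step\<close>).

  So \<open>T \<parallel>g\<parallel>\<^sup>2\<close> for the last \<open>g\<close> is at most the sum of the squares of all of them, which is at
  most \<open>9 \<parallel>z\<^sub>0 - z\<^sup>*\<parallel>\<^sup>2 / (1 - (\<eta> L)\<^sup>2)\<close>.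
\<close>

section \<open>Normal cones and residuals\<close>

lemma diff_closest_point_normal:
  fixes Z :: "'a::euclidean_space set"
  assumes "closed Z" "convex Z"
  shows "x - closest_point Z x \<in> normal_cone Z (closest_point Z x)"
  using closest_point_dot[OF assms(2,1)] by (auto simp: normal_cone_def)

lemma normal_coneD: "v \<in> normal_cone Z z \<Longrightarrow> x \<in> Z \<Longrightarrow> v \<bullet> (x - z) \<le> 0"
  by (simp add: normal_cone_def)

lemma normal_cone_scaleR:
  "v \<in> normal_cone Z z \<Longrightarrow> 0 \<le> r \<Longrightarrow> r *\<^sub>R v \<in> normal_cone Z z"
  by (auto simp: normal_cone_def mult_nonneg_nonpos)

text \<open>
  Moreau's decomposition of \<open>- F z\<close> along the tangent cone: \<open>p\<close> is the projection onto the tangent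
  cone and \<open>- F z - p\<close> is normal to \<open>Z\<close>.
\<close>

lemma tangent_projection_decomposition:
  fixes Z :: "'a::euclidean_space set" and F :: "'a \<Rightarrow> 'a"
  obtains p where "tangent_residual Z F z = norm p" "p \<in> tangent_cone Z z"
    "(F z + p) \<bullet> p = 0" "- F z - p \<in> normal_cone Z z"
proof -
  define S where "S = shifted_tangent_cone Z z"
  define p where "p = closest_point S (z - F z) - z"
  note S = shifted_tangent_cone_closed_convex[of Z z, folded S_def]
  have mem: "z + t \<in> S \<longleftrightarrow> t \<in> tangent_cone Z z" for t
    by (auto simp: S_def shifted_tangent_cone_def)
  have p: "p \<in> tangent_cone Z z"
    using closest_point_in_set[OF S(1) S(3), of "z - F z"] mem[of p] by (simp add: p_def)
  have var: "(- F z - p) \<bullet> (t - p) \<le> 0" if "t \<in> tangent_cone Z z" for t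
  proof -
    have "(z - F z - closest_point S (z - F z)) \<bullet> (z + t - closest_point S (z - F z)) \<le> 0"
      using that by (intro closest_point_dot S) (simp add: mem)
    moreover have "z - F z - closest_point S (z - F z) = - F z - p"
      "z + t - closest_point S (z - F z) = t - p"
      by (simp_all add: p_def)
    ultimately show ?thesis by (simp only:)
  qed
  have "0 \<in> tangent_cone Z z" "2 *\<^sub>R p \<in> tangent_cone Z z"
    using p by (auto simp: tangent_cone_def)
  \<comment> \<open>Testing with \<open>0\<close> and with \<open>2 p\<close> gives orthogonality.\<close>
  from var[OF this(1)] var[OF this(2)] have orth: "(F z + p) \<bullet> p = 0"
    by (simp add: algebra_simps inner_simps scaleR_2)
  have "- F z - p \<in> normal_cone Z z"
    unfolding normal_cone_def
  proof safe
    fix x assume "x \<in> Z"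
    then have "x - z \<in> tangent_cone Z z"
      by (auto simp: tangent_cone_def normal_cone_def inner_commute)
    from var[OF this] orth show "(- F z - p) \<bullet> (x - z) \<le> 0"
      by (simp add: inner_simps)
  qed
  moreover have "tangent_residual Z F z = norm p"
    by (simp add: tangent_residual_def p_def S_def)
  ultimately show ?thesis using that p orth by blast
qed

lemma tangent_residual_eq:
  fixes Z :: "'a::euclidean_space set"
  obtains c where "c \<in> normal_cone Z z" "tangent_residual Z F z = norm (F z + c)"
proof -
  obtain p where "tangent_residual Z F z = norm p" "- F z - p \<in> normal_cone Z z"
    by (rule tangent_projection_decomposition)
  then show ?thesis using that[of "- F z - p"] by simp
qed

lemma le_norm_of_square_le:
  fixes r s :: real
  assumes "r\<^sup>2 \<le> s * r" "0 \<le> r" "0 \<le> s"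
  shows "r \<le> s"
  using assms by (cases "r = 0") (auto simp: power2_eq_square)

lemma tangent_residual_le:
  fixes Z :: "'a::euclidean_space set"
  assumes c: "c \<in> normal_cone Z z"
  shows "tangent_residual Z F z \<le> norm (F z + c)"
proof -
  obtain p where p: "tangent_residual Z F z = norm p" "p \<in> tangent_cone Z z" "(F z + p) \<bullet> p = 0"
    by (rule tangent_projection_decomposition)
  have "p \<bullet> c \<le> 0" using p(2) c by (simp add: tangent_cone_def)
  then have "(norm p)\<^sup>2 \<le> - (F z + c) \<bullet> p"
    using p(3) by (simp add: power2_norm_eq_inner inner_simps inner_commute)
  also have "\<dots> \<le> norm (F z + c) * norm p"
    using norm_cauchy_schwarz[of "- (F z + c)" p] by (simp only: norm_minus_cancel)
  finally show ?thesis
    unfolding p(1) by (rule le_norm_of_square_le) auto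
qed

lemma natural_residual_le:
  fixes Z :: "'a::euclidean_space set"
  assumes "closed Z" "convex Z" "z \<in> Z" and c: "c \<in> normal_cone Z z"
  shows "natural_residual Z F z \<le> norm (F z + c)"
proof -
  define u where "u = closest_point Z (z - F z)"
  have "u \<in> Z" using assms closest_point_in_set unfolding u_def by blast
  then have "c \<bullet> (u - z) \<le> 0" by (rule normal_coneD[OF c])
  moreover have "(z - F z - u) \<bullet> (z - u) \<le> 0"
    unfolding u_def using closest_point_dot assms by blast
  ultimately have "(norm (z - u))\<^sup>2 \<le> (F z + c) \<bullet> (z - u)"
    by (simp add: power2_norm_eq_inner inner_simps inner_commute)
  also have "\<dots> \<le> norm (F z + c) * norm (z - u)" by (rule norm_cauchy_schwarz)
  finally have "norm (z - u) \<le> norm (F z + c)" by (rule le_norm_of_square_le) auto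
  then show ?thesis by (simp add: natural_residual_def u_def)
qed

lemma natural_residual_le_tangent_residual:
  fixes Z :: "'a::euclidean_space set"
  assumes "closed Z" "convex Z" "z \<in> Z"
  shows "natural_residual Z F z \<le> tangent_residual Z F z"
  by (metis tangent_residual_eq natural_residual_le[OF assms])

lemma gap_le:
  fixes Z :: "'a::euclidean_space set"
  assumes "z \<in> Z" "0 \<le> D" and c: "c \<in> normal_cone Z z"
  shows "gap Z F D z \<le> D * norm (F z + c)"
  unfolding gap_def
proof (rule cSUP_least)
  show "Z \<inter> cball z D \<noteq> {}" using assms by auto
  fix x assume x: "x \<in> Z \<inter> cball z D"
  then have "c \<bullet> (x - z) \<le> 0" using c by (auto intro: normal_coneD)
  then have "F z \<bullet> (z - x) \<le> (F z + c) \<bullet> (z - x)" by (simp add: inner_simps)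
  also have "\<dots> \<le> norm (F z + c) * norm (z - x)" by (rule norm_cauchy_schwarz)
  also have "\<dots> \<le> norm (F z + c) * D"
    using x by (intro mult_left_mono) (auto simp: dist_norm)
  finally show "F z \<bullet> (z - x) \<le> D * norm (F z + c)" by (simp add: mult.commute)
qed

section \<open>One extragradient step\<close>

definition eg_step :: "'a::euclidean_space set \<Rightarrow> ('a \<Rightarrow> 'a) \<Rightarrow> real \<Rightarrow> 'a \<Rightarrow> 'a" where
  "eg_step Z F \<eta> z = closest_point Z (z - \<eta> *\<^sub>R F (eg_half Z F \<eta> z))"

lemma eg_Suc_eq_step: "eg Z F \<eta> z0 (Suc k) = eg_step Z F \<eta> (eg Z F \<eta> z0 k)"
  by (simp add: eg_step_def)

text \<open>The normal vector at the next iterate that the second projection provides.\<close>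

definition eg_normal :: "'a::euclidean_space set \<Rightarrow> ('a \<Rightarrow> 'a) \<Rightarrow> real \<Rightarrow> 'a \<Rightarrow> 'a" where
  "eg_normal Z F \<eta> z = z - \<eta> *\<^sub>R F (eg_half Z F \<eta> z) - eg_step Z F \<eta> z"

text \<open>
  The resulting element of \<open>\<eta> F z\<^sup>+ + N\<^sub>Z(z\<^sup>+)\<close>.  The argument is the iterate before the step,
  while the residual belongs to the iterate \<open>z\<^sup>+\<close> after it.
\<close>

definition eg_residual :: "'a::euclidean_space set \<Rightarrow> ('a \<Rightarrow> 'a) \<Rightarrow> real \<Rightarrow> 'a \<Rightarrow> 'a" where
  "eg_residual Z F \<eta> z = \<eta> *\<^sub>R F (eg_step Z F \<eta> z) + eg_normal Z F \<eta> z"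

text \<open>
  With \<open>a\<close>, \<open>m\<close>, \<open>e\<close> the values of \<open>\<eta> F\<close> at \<open>z\<close>, \<open>w\<close>, \<open>z\<^sup>+\<close> and \<open>c\<close>, \<open>b\<close>, \<open>d\<close> normal vectors at these
  points, one has \<open>z - w = a + b\<close> and \<open>z - z\<^sup>+ = m + d\<close>.
\<close>

lemma eg_square_identity:
  fixes a b c d e m :: "'a::real_inner"
  shows "(norm (a + c))\<^sup>2 - (norm (e + d))\<^sup>2 =
    2 * ((a - e) \<bullet> (m + d)) + ((norm (a + b - m - d))\<^sup>2 - (norm (e - m))\<^sup>2) + (norm (b - c))\<^sup>2
    - 2 * (d \<bullet> (m + d)) - 2 * (b \<bullet> (a + b - m - d)) + 2 * (c \<bullet> (a + b))"
  by (simp add: power2_norm_eq_inner inner_simps inner_commute)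

context
  fixes Z :: "'a::euclidean_space set" and F :: "'a \<Rightarrow> 'a" and L \<eta> :: real
  assumes Z: "closed Z" "convex Z"
    and mono: "monotone_operator_on Z F"
    and lip: "L-lipschitz_on Z F"
    and \<eta>: "0 \<le> \<eta>" "\<eta> * L \<le> 1"
begin

lemma eg_half_in: "z \<in> Z \<Longrightarrow> eg_half Z F \<eta> z \<in> Z"
  using Z closest_point_in_set unfolding eg_half_def by blast

lemma eg_step_in: "z \<in> Z \<Longrightarrow> eg_step Z F \<eta> z \<in> Z"
  using Z closest_point_in_set unfolding eg_step_def by blast

lemma eg_normal_in: "eg_normal Z F \<eta> z \<in> normal_cone Z (eg_step Z F \<eta> z)"
  unfolding eg_normal_def eg_step_def by (rule diff_closest_point_normal[OF Z])

lemma scaled_lipschitz: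
  assumes "x \<in> Z" "y \<in> Z"
  shows "norm (\<eta> *\<^sub>R F x - \<eta> *\<^sub>R F y) \<le> \<eta> * L * norm (x - y)"
proof -
  have "norm (\<eta> *\<^sub>R F x - \<eta> *\<^sub>R F y) = \<eta> * norm (F x - F y)"
    using \<eta> by (simp flip: scaleR_diff_right)
  also have "\<dots> \<le> \<eta> * (L * norm (x - y))"
    using lipschitz_onD[OF lip assms] \<eta> by (intro mult_left_mono) (auto simp: dist_norm)
  finally show ?thesis by (simp add: mult.assoc)
qed

lemma eta_L_nonneg: "0 \<le> \<eta> * L"
  using \<eta> lipschitz_on_nonneg[OF lip] by simp

lemma scaled_lipschitz_1:
  assumes "x \<in> Z" "y \<in> Z"
  shows "norm (\<eta> *\<^sub>R F x - \<eta> *\<^sub>R F y) \<le> norm (x - y)"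
  using scaled_lipschitz[OF assms] mult_right_mono[OF \<eta>(2) norm_ge_zero[of "x - y"]] by simp

lemma eg_residual_decreasing:
  assumes z: "z \<in> Z" and c: "c \<in> normal_cone Z z"
  shows "norm (eg_residual Z F \<eta> z) \<le> norm (\<eta> *\<^sub>R F z + c)"
proof -
  define w zp where "w = eg_half Z F \<eta> z" and "zp = eg_step Z F \<eta> z"
  define a m e where "a = \<eta> *\<^sub>R F z" and "m = \<eta> *\<^sub>R F w" and "e = \<eta> *\<^sub>R F zp"
  define b d where "b = z - a - w" and "d = eg_normal Z F \<eta> z"
  have in_Z: "w \<in> Z" "zp \<in> Z"
    using eg_half_in[OF z] eg_step_in[OF z] by (auto simp: w_def zp_def)
  have d_eq: "d = z - m - zp"
    by (simp add: d_def eg_normal_def m_def w_def zp_def)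
  have b: "b \<in> normal_cone Z w"
    unfolding b_def a_def w_def eg_half_def by (rule diff_closest_point_normal[OF Z])
  have d: "d \<in> normal_cone Z zp"
    unfolding d_def zp_def by (rule eg_normal_in)
  have diffs: "z - zp = m + d" "zp - w = a + b - m - d" "z - w = a + b"
    by (auto simp: b_def d_eq)
  have "0 \<le> \<eta> * ((F z - F zp) \<bullet> (z - zp))"
    using mono z in_Z \<eta> by (auto simp: monotone_operator_on_def)
  then have 1: "0 \<le> (a - e) \<bullet> (m + d)"
    by (simp add: diffs a_def e_def flip: scaleR_diff_right)
  have "(norm (e - m))\<^sup>2 \<le> (norm (zp - w))\<^sup>2"
    unfolding e_def m_def by (rule power_mono[OF scaled_lipschitz_1[OF in_Z(2,1)] norm_ge_zero])
  then have 2: "(norm (e - m))\<^sup>2 \<le> (norm (a + b - m - d))\<^sup>2" by (simp only: diffs)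
  have 3: "d \<bullet> (m + d) \<le> 0" using normal_coneD[OF d z] by (simp only: diffs)
  have 4: "b \<bullet> (a + b - m - d) \<le> 0" using normal_coneD[OF b in_Z(2)] by (simp only: diffs)
  have "c \<bullet> (w - z) = - (c \<bullet> (a + b))" by (simp add: inner_diff_right flip: diffs(3))
  then have 5: "0 \<le> c \<bullet> (a + b)" using normal_coneD[OF c in_Z(1)] by simp
  have "(norm (e + d))\<^sup>2 \<le> (norm (a + c))\<^sup>2"
    using eg_square_identity[of a c e d m b] 1 2 3 4 5 zero_le_power2[of "norm (b - c)"]
    by linarith
  then have "norm (e + d) \<le> norm (a + c)" by (rule power2_le_imp_le) simp
  then show ?thesis by (simp add: eg_residual_def a_def e_def d_def zp_def)
qed

lemma eg_step_half_le:
  assumes z: "z \<in> Z"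
  shows "norm (eg_step Z F \<eta> z - eg_half Z F \<eta> z) \<le> norm (z - eg_half Z F \<eta> z)"
proof -
  define w where "w = eg_half Z F \<eta> z"
  have w: "w \<in> Z" using eg_half_in[OF z] by (simp add: w_def)
  \<comment> \<open>Both points are projections, and projections are nonexpansive.\<close>
  have "dist (eg_step Z F \<eta> z) w \<le> dist (z - \<eta> *\<^sub>R F w) (z - \<eta> *\<^sub>R F z)"
    using closest_point_lipschitz[OF Z(2,1)] z by (auto simp: eg_step_def w_def eg_half_def)
  also have "\<dots> = norm (\<eta> *\<^sub>R F z - \<eta> *\<^sub>R F w)" by (simp add: dist_norm)
  also have "\<dots> \<le> norm (z - w)" by (rule scaled_lipschitz_1[OF z w])
  finally show ?thesis by (simp add: dist_norm w_def)
qed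

lemma eg_residual_le_half_step:
  assumes z: "z \<in> Z"
  shows "norm (eg_residual Z F \<eta> z) \<le> 3 * norm (z - eg_half Z F \<eta> z)"
proof -
  define w zp where "w = eg_half Z F \<eta> z" and "zp = eg_step Z F \<eta> z"
  have "eg_residual Z F \<eta> z = (z - w) + (w - zp) + (\<eta> *\<^sub>R F zp - \<eta> *\<^sub>R F w)"
    by (simp add: eg_residual_def eg_normal_def w_def zp_def)
  then have "norm (eg_residual Z F \<eta> z)
      \<le> norm (z - w) + norm (w - zp) + norm (\<eta> *\<^sub>R F zp - \<eta> *\<^sub>R F w)"
    by (metis add_mono norm_triangle_le order_refl norm_triangle_ineq)
  also have "norm (\<eta> *\<^sub>R F zp - \<eta> *\<^sub>R F w) \<le> norm (zp - w)"
    using eg_half_in[OF z] eg_step_in[OF z]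
    by (intro scaled_lipschitz_1) (auto simp: w_def zp_def)
  finally show ?thesis
    using eg_step_half_le[OF z] by (simp add: w_def zp_def norm_minus_commute)
qed

text \<open>The distance to a solution decreases by a multiple of the squared half step.\<close>

lemma eg_step_fejer:
  assumes z: "z \<in> Z" and sol: "vi_solution Z F zs"
  shows "(1 - (\<eta> * L)\<^sup>2) * (norm (z - eg_half Z F \<eta> z))\<^sup>2
    \<le> (norm (z - zs))\<^sup>2 - (norm (eg_step Z F \<eta> z - zs))\<^sup>2"
proof -
  define w zp where "w = eg_half Z F \<eta> z" and "zp = eg_step Z F \<eta> z"
  define a m where "a = \<eta> *\<^sub>R F z" and "m = \<eta> *\<^sub>R F w"
  have in_Z: "w \<in> Z" "zp \<in> Z" "zs \<in> Z"
    using eg_half_in[OF z] eg_step_in[OF z] sol by (auto simp: w_def zp_def vi_solution_def)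
  have "0 \<le> (F w - F zs) \<bullet> (w - zs)" "0 \<le> F zs \<bullet> (w - zs)"
    using mono sol in_Z by (auto simp: monotone_operator_on_def vi_solution_def inner_simps)
  then have "0 \<le> F w \<bullet> (w - zs)" by (simp add: inner_simps)
  then have 1: "0 \<le> m \<bullet> (w - zs)" using \<eta> by (simp add: m_def)
  have 2: "(z - m - zp) \<bullet> (zs - zp) \<le> 0"
    using normal_coneD[OF eg_normal_in in_Z(3)] by (simp add: eg_normal_def m_def w_def zp_def)
  have 3: "(z - a - w) \<bullet> (zp - w) \<le> 0"
    unfolding a_def w_def eg_half_def
    using normal_coneD[OF diff_closest_point_normal[OF Z] in_Z(2)] .
  have "(a - m) \<bullet> (zp - w) \<le> norm (a - m) * norm (zp - w)" by (rule norm_cauchy_schwarz)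
  also have "\<dots> \<le> (\<eta> * L * norm (z - w)) * norm (zp - w)"
    unfolding a_def m_def by (intro mult_right_mono scaled_lipschitz z in_Z) simp
  finally have "2 * ((a - m) \<bullet> (zp - w)) \<le> 2 * (\<eta> * L * norm (z - w)) * norm (zp - w)" by simp
  also have "\<dots> \<le> (\<eta> * L * norm (z - w))\<^sup>2 + (norm (zp - w))\<^sup>2"
    by (rule sum_squares_bound)
  finally have 4: "2 * ((a - m) \<bullet> (zp - w)) \<le> (\<eta> * L)\<^sup>2 * (norm (z - w))\<^sup>2 + (norm (zp - w))\<^sup>2"
    by (simp add: power_mult_distrib)
  have "(norm (z - zs))\<^sup>2 - (norm (zp - zs))\<^sup>2 = (norm (z - w))\<^sup>2 + (norm (zp - w))\<^sup>2
    - 2 * ((a - m) \<bullet> (zp - w)) - 2 * ((z - a - w) \<bullet> (zp - w))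
    - 2 * ((z - m - zp) \<bullet> (zs - zp)) + 2 * (m \<bullet> (w - zs))"
    by (simp add: power2_norm_eq_inner inner_simps inner_commute)
  then have "(1 - (\<eta> * L)\<^sup>2) * (norm (z - w))\<^sup>2 \<le> (norm (z - zs))\<^sup>2 - (norm (zp - zs))\<^sup>2"
    using 1 2 3 4 unfolding left_diff_distrib mult_1 by linarith
  then show ?thesis by (simp add: w_def zp_def)
qed

section \<open>The last iterate\<close>

lemma eg_in: "z0 \<in> Z \<Longrightarrow> eg Z F \<eta> z0 k \<in> Z"
  by (induction k) (simp_all only: eg_Suc_eq_step eg_step_in eg.simps(1))

lemma eg_residual_antimono:
  assumes "z0 \<in> Z" "j \<le> k"
  shows "norm (eg_residual Z F \<eta> (eg Z F \<eta> z0 k)) \<le> norm (eg_residual Z F \<eta> (eg Z F \<eta> z0 j))"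
proof (rule lift_Suc_antimono_le[OF _ assms(2)])
  fix k
  let ?z = "eg Z F \<eta> z0 k"
  show "norm (eg_residual Z F \<eta> (eg Z F \<eta> z0 (Suc k))) \<le> norm (eg_residual Z F \<eta> ?z)"
    unfolding eg_Suc_eq_step eg_residual_def[of _ _ _ ?z]
    by (intro eg_residual_decreasing eg_step_in eg_in eg_normal_in assms)
qed

lemma eg_half_steps_sum_le:
  assumes z0: "z0 \<in> Z" and sol: "vi_solution Z F zs"
  shows "(1 - (\<eta> * L)\<^sup>2) * (\<Sum>k<T. (norm (eg Z F \<eta> z0 k - eg_half Z F \<eta> (eg Z F \<eta> z0 k)))\<^sup>2)
    \<le> (norm (z0 - zs))\<^sup>2"
proof -
  let ?z = "eg Z F \<eta> z0"
  have "(1 - (\<eta> * L)\<^sup>2) * (\<Sum>k<T. (norm (?z k - eg_half Z F \<eta> (?z k)))\<^sup>2)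
    \<le> (\<Sum>k<T. (norm (?z k - zs))\<^sup>2 - (norm (?z (Suc k) - zs))\<^sup>2)"
    unfolding sum_distrib_left eg_Suc_eq_step
    by (intro sum_mono eg_step_fejer eg_in z0 sol)
  also have "\<dots> = (norm (z0 - zs))\<^sup>2 - (norm (?z T - zs))\<^sup>2"
    by (subst sum_lessThan_telescope') simp
  finally show ?thesis using zero_le_power2[of "norm (?z T - zs)"] by linarith
qed

lemma eg_residual_last_iterate:
  assumes z0: "z0 \<in> Z" and sol: "vi_solution Z F zs" and lt: "\<eta> * L < 1"
  shows "norm (eg_residual Z F \<eta> (eg Z F \<eta> z0 n))
    \<le> 3 * norm (z0 - zs) / (sqrt (real (Suc n)) * sqrt (1 - (\<eta> * L)\<^sup>2))"
proof -
  let ?z = "eg Z F \<eta> z0"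
  let ?g = "norm (eg_residual Z F \<eta> (?z n))"
  let ?q = "1 - (\<eta> * L)\<^sup>2"
  have q: "0 < ?q" using lt eta_L_nonneg by (simp add: power_less_one_iff abs_square_less_1)
  have "?g\<^sup>2 \<le> 9 * (norm (?z k - eg_half Z F \<eta> (?z k)))\<^sup>2" if "k < Suc n" for k
  proof -
    have "?g \<le> norm (eg_residual Z F \<eta> (?z k))"
      using that by (intro eg_residual_antimono z0) simp
    also have "\<dots> \<le> 3 * norm (?z k - eg_half Z F \<eta> (?z k))"
      by (intro eg_residual_le_half_step eg_in z0)
    finally have "?g\<^sup>2 \<le> (3 * norm (?z k - eg_half Z F \<eta> (?z k)))\<^sup>2"
      by (rule power_mono) simp
    then show ?thesis by (simp add: power_mult_distrib)
  qed
  then have "(\<Sum>k<Suc n. ?g\<^sup>2) \<le> (\<Sum>k<Suc n. 9 * (norm (?z k - eg_half Z F \<eta> (?z k)))\<^sup>2)"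
    by (intro sum_mono) simp
  then have "real (Suc n) * ?g\<^sup>2 \<le> 9 * (\<Sum>k<Suc n. (norm (?z k - eg_half Z F \<eta> (?z k)))\<^sup>2)"
    by (simp only: sum_constant card_lessThan flip: sum_distrib_left)
  from mult_left_mono[OF this less_imp_le[OF q]] eg_half_steps_sum_le[OF z0 sol, of "Suc n"]
  have "real (Suc n) * ?q * ?g\<^sup>2 \<le> 9 * (norm (z0 - zs))\<^sup>2"
    by (simp only: mult.assoc mult.left_commute)
  then have "sqrt (real (Suc n) * ?q * ?g\<^sup>2) \<le> sqrt (9 * (norm (z0 - zs))\<^sup>2)"
    by (simp only: real_sqrt_le_iff)
  also have "sqrt (9 * (norm (z0 - zs))\<^sup>2) = 3 * norm (z0 - zs)"
    using real_sqrt_abs[of "3 * norm (z0 - zs)"] by (simp add: power_mult_distrib)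
  finally have "?g * (sqrt (real (Suc n)) * sqrt ?q) \<le> 3 * norm (z0 - zs)"
    by (simp add: real_sqrt_mult mult_ac)
  moreover have "0 < sqrt (real (Suc n)) * sqrt ?q" using q by simp
  ultimately show ?thesis by (simp only: pos_le_divide_eq)
qed

end

theorem theorem3:
  fixes Z :: "(real ^ 'n) set" and F :: "real ^ 'n \<Rightarrow> real ^ 'n"
    and L \<eta> D :: real and z0 zs :: "real ^ 'n" and T :: nat
  assumes "closed Z" and "convex Z"
    and "monotone_operator_on Z F"
    and "L > 0" and "L-lipschitz_on Z F"
    and "vi_solution Z F zs"
    and "z0 \<in> Z"
    and "0 < \<eta>" and "\<eta> < 1 / L"
    and "T \<ge> 1" and "D > 0"
  shows "gap Z F D (eg Z F \<eta> z0 T)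
           \<le> 1 / sqrt (real T) * (3 * D * norm (z0 - zs) / (\<eta> * sqrt (1 - (\<eta> * L)\<^sup>2)))
       \<and> natural_residual Z F (eg Z F \<eta> z0 T) \<le> tangent_residual Z F (eg Z F \<eta> z0 T)
       \<and> tangent_residual Z F (eg Z F \<eta> z0 T)
           \<le> 1 / sqrt (real T) * (3 * norm (z0 - zs) / (\<eta> * sqrt (1 - (\<eta> * L)\<^sup>2)))"
proof -
  let ?z = "eg Z F \<eta> z0"
  have \<eta>L: "\<eta> * L < 1" using \<open>\<eta> < 1 / L\<close> \<open>L > 0\<close> by (simp add: field_simps)
  note ctx = assms(1-3,5) less_imp_le[OF \<open>0 < \<eta>\<close>] less_imp_le[OF \<eta>L]
  obtain n where n: "T = Suc n" using \<open>T \<ge> 1\<close> by (cases T) auto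
  have zT: "?z T \<in> Z" using eg_in[OF ctx] assms by blast
  \<comment> \<open>Undo the scaling by \<open>\<eta>\<close> that is built into the residual vector of a step.\<close>
  define c where "c = (1 / \<eta>) *\<^sub>R eg_normal Z F \<eta> (?z n)"
  have step: "?z T = eg_step Z F \<eta> (?z n)"
    unfolding n by (rule eg_Suc_eq_step)
  have c: "c \<in> normal_cone Z (?z T)"
    unfolding c_def step using \<open>0 < \<eta>\<close> eg_normal_in[OF ctx] by (intro normal_cone_scaleR) auto
  define B where "B = 1 / sqrt (real T) * (3 * norm (z0 - zs) / (\<eta> * sqrt (1 - (\<eta> * L)\<^sup>2)))"
  have "eg_residual Z F \<eta> (?z n) = \<eta> *\<^sub>R (F (?z T) + c)"
    using \<open>0 < \<eta>\<close> by (simp add: eg_residual_def c_def step scaleR_add_right)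
  then have "\<eta> * norm (F (?z T) + c) = norm (eg_residual Z F \<eta> (?z n))"
    using \<open>0 < \<eta>\<close> by simp
  also have "\<dots> \<le> 3 * norm (z0 - zs) / (sqrt (real T) * sqrt (1 - (\<eta> * L)\<^sup>2))"
    unfolding n by (rule eg_residual_last_iterate[OF ctx \<open>z0 \<in> Z\<close> \<open>vi_solution Z F zs\<close> \<eta>L])
  also have "\<dots> = \<eta> * B" using \<open>0 < \<eta>\<close> by (simp add: B_def)
  finally have res: "norm (F (?z T) + c) \<le> B" using \<open>0 < \<eta>\<close> by simp
  have "gap Z F D (?z T) \<le> D * norm (F (?z T) + c)"
    using gap_le[OF zT _ c] \<open>D > 0\<close> by simp
  also have "\<dots> \<le> D * B" using res \<open>D > 0\<close> by simp
  also have "\<dots> = 1 / sqrt (real T) * (3 * D * norm (z0 - zs) / (\<eta> * sqrt (1 - (\<eta> * L)\<^sup>2)))"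
    by (simp add: B_def)
  finally have "gap Z F D (?z T)
    \<le> 1 / sqrt (real T) * (3 * D * norm (z0 - zs) / (\<eta> * sqrt (1 - (\<eta> * L)\<^sup>2)))" .
  moreover have "natural_residual Z F (?z T) \<le> tangent_residual Z F (?z T)"
    using assms zT by (intro natural_residual_le_tangent_residual)
  moreover have "tangent_residual Z F (?z T) \<le> B"
    using tangent_residual_le[OF c] res by (rule order_trans)
  ultimately show ?thesis unfolding B_def by blast
qed

end
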